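(* Let $K$ be a field of characteristic different from $2$, let $G$ be a group, let $UT_n$ ($n\ge 1$) be endowed with an elementary $G$-grading $\Gamma$, and let $\theta:\mathrm{Supp}\,\Gamma\to\mathrm{Supp}\,\Gamma$ be a bijection. Then an arbitrary homogeneous antiautomorphism (respectively, homogeneous involution) $\varphi$ of $UT_n$ is $\theta$-homogeneous if and only if the canonical involution $\circ$ is $\theta$-homogeneous.
   Context: $UT_n$ is the associative $K$-algebra of $n\times n$ upper triangular matrices over $K$, with matrix units $E_{i,j}$ ($i\le j$). A $G$-grading $\Gamma$ on an algebra $A$ is a decomposition $A=\bigoplus_{g\in G}A_g$ into subspaces with $A_gA_h\subseteq A_{gh}$ for all $g,h\in G$; its support is $\mathrm{Supp}\,\Gamma=\{g\in G: A_g\neq\{0\}\}$; an element of $A_g$ is called homogeneous of degree $g$. A $G$-grading on $UT_n$ is elementary if every matrix unit is homogeneous and there is $(h_1,\dots,h_n)\in G^n$ with $\deg E_{i,j}=h_i^{-1}h_j$ for all $i\le j$. An antiautomorphism of an algebra $A$ is a bijective linear map $\varphi:A\to A$ with $\varphi(xy)=\varphi(y)\varphi(x)$ for all $x,y$; an involution is an antiautomorphism with $\varphi^2=\mathrm{id}$. The canonical involution (reflection involution) $\circ$ on $UT_n$ is the linear map with $E_{i,j}^\circ=E_{n-j+1,n-i+1}$ for $1\le i\le j\le n$. An antiautomorphism or involution $\varphi:A\to A$ is $\theta$-homogeneous, for a bijection $\theta:\mathrm{Supp}\,\Gamma\to\mathrm{Supp}\,\Gamma$, if $\varphi(A_g)=A_{\theta(g)}$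 for every $g\in\mathrm{Supp}\,\Gamma$; it is homogeneous if it is $\theta$-homogeneous for some such bijection $\theta$. *)

theory Defs
  imports "Jordan_Normal_Form.VS_Connect"
begin

text \<open>The field is a type of class \<open>field\<close>, viewed as an HOL-Algebra ring through
  \<^term>\<open>class_ring\<close>. An algebra over it is a \<^typ>\<open>('k, 'm) module\<close> record, which has the ring
  operations of the algebra next to the scalar multiplication; the locale \<open>algebra\<close> of HOL-Algebra
  does not apply because it requires the multiplication to be commutative.\<close>

definition support ::
    "('g, 'b) monoid_scheme \<Rightarrow> ('k, 'm) module \<Rightarrow> ('g \<Rightarrow> 'm set) \<Rightarrow> 'g set" where
  "support G A \<Gamma> = {g \<in> carrier G. \<Gamma> g \<noteq> {\<zero>\<^bsub>A\<^esub>}}"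

text \<open>The last conjunct says that \<open>A\<close> is the direct sum of the components: every element is in a
  unique way a finite sum of elements of the components. The family \<open>f\<close> is extensional, so that
  its values outside \<open>carrier G\<close> do not affect uniqueness.\<close>

definition group_grading ::
    "('g, 'b) monoid_scheme \<Rightarrow> ('k::field, 'm) module \<Rightarrow> ('g \<Rightarrow> 'm set) \<Rightarrow> bool" where
  "group_grading G A \<Gamma> \<longleftrightarrow>
     (\<forall>g\<in>carrier G. subspace class_ring (\<Gamma> g) A) \<and>
     (\<forall>g\<in>carrier G. \<forall>h\<in>carrier G. \<forall>x\<in>\<Gamma> g. \<forall>y\<in>\<Gamma> h. x \<otimes>\<^bsub>A\<^esub> y \<in> \<Gamma> (g \<otimes>\<^bsub>G\<^esub> h)) \<and>
     (\<forall>x\<in>carrier A. \<exists>!f. f \<in> (\<Pi>\<^sub>E g\<in>carrier G. \<Gamma> g) \<and>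
        finite {g \<in> carrier G. f g \<noteq> \<zero>\<^bsub>A\<^esub>} \<and>
        x = finsum A f {g \<in> carrier G. f g \<noteq> \<zero>\<^bsub>A\<^esub>})"

definition antiautomorphism :: "('k::field, 'm) module \<Rightarrow> ('m \<Rightarrow> 'm) \<Rightarrow> bool" where
  "antiautomorphism A \<phi> \<longleftrightarrow>
     linear_map class_ring A A \<phi> \<and> bij_betw \<phi> (carrier A) (carrier A) \<and>
     (\<forall>x\<in>carrier A. \<forall>y\<in>carrier A. \<phi> (x \<otimes>\<^bsub>A\<^esub> y) = \<phi> y \<otimes>\<^bsub>A\<^esub> \<phi> x)"

definition involution :: "('k::field, 'm) module \<Rightarrow> ('m \<Rightarrow> 'm) \<Rightarrow> bool" where
  "involution A \<phi> \<longleftrightarrow> antiautomorphism A \<phi> \<and> (\<forall>x\<in>carrier A. \<phi> (\<phi> x) = x)"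

definition theta_homogeneous ::
    "('g, 'b) monoid_scheme \<Rightarrow> ('k, 'm) module \<Rightarrow> ('g \<Rightarrow> 'm set) \<Rightarrow> ('g \<Rightarrow> 'g) \<Rightarrow> ('m \<Rightarrow> 'm) \<Rightarrow> bool"
  where
  "theta_homogeneous G A \<Gamma> \<theta> \<phi> \<longleftrightarrow>
     bij_betw \<theta> (support G A \<Gamma>) (support G A \<Gamma>) \<and>
     (\<forall>g\<in>support G A \<Gamma>. \<phi> ` \<Gamma> g = \<Gamma> (\<theta> g))"

definition homogeneous ::
    "('g, 'b) monoid_scheme \<Rightarrow> ('k, 'm) module \<Rightarrow> ('g \<Rightarrow> 'm set) \<Rightarrow> ('m \<Rightarrow> 'm) \<Rightarrow> bool" where
  "homogeneous G A \<Gamma> \<phi> \<longleftrightarrow> (\<exists>\<theta>. theta_homogeneous G A \<Gamma> \<theta> \<phi>)"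

definition UT :: "nat \<Rightarrow> ('k::field, 'k mat) module" where
  "UT n = (module_mat TYPE('k) n n)\<lparr>carrier := {X \<in> carrier_mat n n. upper_triangular X}\<rparr>"

text \<open>Rows and columns are numbered from \<open>0\<close>, so \<open>matrix_unit n i j\<close> is $E_{i+1,j+1}$ and the
  reflection $E_{i,j} \mapsto E_{n-j+1,n-i+1}$ replaces \<open>(i, j)\<close> by \<open>(n - 1 - j, n - 1 - i)\<close>.\<close>

definition matrix_unit :: "nat \<Rightarrow> nat \<Rightarrow> nat \<Rightarrow> 'k::field mat" where
  "matrix_unit n i j = mat n n (\<lambda>p. if p = (i, j) then 1 else 0)"

definition canonical_involution :: "nat \<Rightarrow> 'k mat \<Rightarrow> 'k mat" where
  "canonical_involution n X = mat n n (\<lambda>(i, j). X $$ (n - 1 - j, n - 1 - i))"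

definition elementary_grading ::
    "('g, 'b) monoid_scheme \<Rightarrow> nat \<Rightarrow> ('g \<Rightarrow> 'k::field mat set) \<Rightarrow> bool" where
  "elementary_grading G n \<Gamma> \<longleftrightarrow>
     group_grading G (UT n) \<Gamma> \<and>
     (\<exists>h \<in> {..<n} \<rightarrow> carrier G. \<forall>i j. i \<le> j \<and> j < n \<longrightarrow>
        matrix_unit n i j \<in> \<Gamma> (inv\<^bsub>G\<^esub> h i \<otimes>\<^bsub>G\<^esub> h j))"

lemma UT_simps:
  "carrier (UT n :: ('k::field, 'k mat) module) = {X \<in> carrier_mat n n. upper_triangular X}"
  "mult (UT n :: ('k, 'k mat) module) = (*)"
  "one (UT n :: ('k, 'k mat) module) = 1\<^sub>m n"
  "zero (UT n :: ('k, 'k mat) module) = 0\<^sub>m n n"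
  "add (UT n :: ('k, 'k mat) module) = (+)"
  "smult (UT n :: ('k, 'k mat) module) = (\<cdot>\<^sub>m)"
  by (simp_all add: UT_def module_mat_def)

lemma canonical_involution_matrix_unit:
  assumes "i \<le> j" "j < n"
  shows "canonical_involution n (matrix_unit n i j) = matrix_unit n (n - 1 - j) (n - 1 - i)"
  using assms by (intro eq_matI) (auto simp: canonical_involution_def matrix_unit_def)

lemma vectorspace_UT: "vectorspace class_ring (UT n :: ('k::field, 'k mat) module)"
proof -
  have neg: "\<exists>Y. Y \<in> carrier_mat n n \<and> (\<forall>i<dim_row Y. \<forall>j<i. Y $$ (i, j) = 0) \<and>
      Y + X = 0\<^sub>m n n \<and> X + Y = 0\<^sub>m n n"
    if "X \<in> carrier_mat n n" "\<forall>i<n. \<forall>j<i. X $$ (i, j) = 0" for X :: "'k mat"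
    using that by (intro exI[of _ "- X"]) auto
  have "abelian_group (UT n :: ('k, 'k mat) module)"
    by unfold_locales (auto simp: UT_simps Units_def upper_triangular_def neg)
  then have "Module.module class_ring (UT n :: ('k, 'k mat) module)"
    by (intro moduleI) (auto simp: UT_simps upper_triangular_def add_smult_distrib_left_mat
        add_smult_distrib_right_mat domain.axioms(1)[OF field.axioms(1)[OF class_field]])
  then show ?thesis
    by (simp add: vectorspace_def class_field)
qed

lemma involution_canonical_involution:
  "involution (UT n :: ('k::field, 'k mat) module) (canonical_involution n)"
proof -
  let ?A = "UT n :: ('k, 'k mat) module" and ?c = "canonical_involution n :: 'k mat \<Rightarrow> 'k mat"
  have closed: "?c X \<in> carrier ?A" if "X \<in> carrier ?A" for X
    using that by (auto simp: UT_simps canonical_involution_def upper_triangular_def)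
  have invol: "?c (?c X) = X" if "X \<in> carrier ?A" for X
    using that by (auto simp: UT_simps canonical_involution_def intro!: eq_matI)
  have "bij_betw ?c (carrier ?A) (carrier ?A)"
    by (rule bij_betw_byWitness[where f' = ?c]) (auto simp: closed invol)
  moreover have "linear_map class_ring ?A ?A ?c"
    unfolding linear_map_def mod_hom_def mod_hom_axioms_def LinearCombinations.module_hom_def
    using vectorspace_UT[where 'k = 'k, of n] closed
    by (auto simp: vectorspace_def UT_simps canonical_involution_def intro!: eq_matI)
  moreover have "?c (X * Y) = ?c Y * ?c X" if "X \<in> carrier ?A" "Y \<in> carrier ?A" for X Y
  proof (rule eq_matI)
    fix i j assume "i < dim_row (?c Y * ?c X)" "j < dim_col (?c Y * ?c X)"
    then have ij: "i < n" "j < n" by (auto simp: canonical_involution_def)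
    have "?c (X * Y) $$ (i, j) = (\<Sum>k<n. X $$ (n - 1 - j, k) * Y $$ (k, n - 1 - i))"
      using that ij by (auto simp: UT_simps canonical_involution_def scalar_prod_def lessThan_atLeast0)
    also have "\<dots> = (\<Sum>k<n. X $$ (n - 1 - j, n - 1 - k) * Y $$ (n - 1 - k, n - 1 - i))"
      by (rule sum.reindex_bij_witness[where i = "\<lambda>k. n - 1 - k" and j = "\<lambda>k. n - 1 - k"]) auto
    also have "\<dots> = (?c Y * ?c X) $$ (i, j)"
      using that ij by (auto simp: UT_simps canonical_involution_def scalar_prod_def
          lessThan_atLeast0 mult.commute intro!: sum.cong)
    finally show "?c (X * Y) $$ (i, j) = (?c Y * ?c X) $$ (i, j)" .
  qed (use that in \<open>auto simp: UT_simps canonical_involution_def\<close>)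
  ultimately show ?thesis
    using invol by (auto simp: involution_def antiautomorphism_def UT_simps)
qed

end

theory Submission
  imports Defs
begin

text \<open>The point is that \<open>\<phi>(E\<^sub>i\<^sub>j)\<close> has a nonzero entry at the reflected position, for every
  antiautomorphism \<open>\<phi>\<close>. The images of the diagonal matrix units are orthogonal idempotents, each
  with exactly one nonzero diagonal entry, at a position \<open>\<tau> i\<close>. Such a triangular idempotent has
  rank one, which forces the entry of \<open>\<phi>(E\<^sub>i\<^sub>j)\<close> at \<open>(\<tau> j, \<tau> i)\<close> to be nonzero; triangularity then
  makes \<open>\<tau>\<close> order reversing, so \<open>\<tau>\<close> is the reflection. Components of an elementary grading are
  spanned by matrix units, so if \<open>\<phi>\<close> is homogeneous with respect to \<open>\<sigma>\<close>, the reflection is as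
  well, and \<open>\<sigma>\<close> is determined by either of the two maps.\<close>

section \<open>Entries of products of triangular matrices and matrix units\<close>

lemma index_mult_mat_sum:
  assumes "X \<in> carrier_mat n n" "Y \<in> carrier_mat n n" "a < n" "b < n"
  shows "(X * Y) $$ (a, b) = (\<Sum>k<n. X $$ (a, k) * Y $$ (k, b))"
  using assms by (auto simp: scalar_prod_def lessThan_atLeast0)

lemma UT_below_diag:
  assumes "X \<in> carrier (UT n)" "a < n" "b < a"
  shows "X $$ (a, b) = 0"
  using assms by (auto simp: UT_simps)

lemma UT_carrier_mat: "X \<in> carrier (UT n) \<Longrightarrow> X \<in> carrier_mat n n"
  by (simp add: UT_simps)

text \<open>For \<open>l \<noteq> k\<close> one of \<open>X $$ (k, l)\<close> and
  \<open>Y $$ (l, k)\<close> lies below the diagonal. This later separates the diagonals of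
  orthogonal idempotents.\<close>

lemma UT_mult_diag:
  assumes "X \<in> carrier (UT n)" "Y \<in> carrier (UT n)" "k < n"
  shows "(X * Y) $$ (k, k) = X $$ (k, k) * Y $$ (k, k)"
proof -
  have "(X * Y) $$ (k, k) = (\<Sum>l<n. X $$ (k, l) * Y $$ (l, k))"
    using assms by (simp add: index_mult_mat_sum UT_carrier_mat)
  also have "\<dots> = (\<Sum>l\<in>{k}. X $$ (k, l) * Y $$ (l, k))"
  proof (rule sum.mono_neutral_right)
    show "\<forall>l\<in>{..<n} - {k}. X $$ (k, l) * Y $$ (l, k) = 0"
    proof
      fix l assume "l \<in> {..<n} - {k}"
      then have "l < n" "l < k \<or> k < l" by auto
      then show "X $$ (k, l) * Y $$ (l, k) = 0"
        using UT_below_diag[OF assms(1,3)] UT_below_diag[OF assms(2)] by auto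
    qed
  qed (use assms in auto)
  finally show ?thesis by simp
qed

lemma matrix_unit_in_UT: "i \<le> j \<Longrightarrow> j < n \<Longrightarrow> matrix_unit n i j \<in> carrier (UT n)"
  by (auto simp: UT_simps matrix_unit_def upper_triangular_def)

lemma matrix_unit_carrier [simp]: "matrix_unit n i j \<in> carrier_mat n n"
  by (simp add: matrix_unit_def)

lemma matrix_unit_dim [simp]:
  "dim_row (matrix_unit n i j) = n" "dim_col (matrix_unit n i j) = n"
  by (simp_all add: matrix_unit_def)

lemma matrix_unit_index [simp]:
  "a < n \<Longrightarrow> b < n \<Longrightarrow> matrix_unit n i j $$ (a, b) = (if a = i \<and> b = j then 1 else 0)"
  by (simp add: matrix_unit_def)

lemma matrix_unit_nonzero:
  assumes "i < n" "j < n"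
  shows "matrix_unit n i j \<noteq> (0\<^sub>m n n :: 'k::field mat)"
proof
  assume "matrix_unit n i j = (0\<^sub>m n n :: 'k mat)"
  then have "(matrix_unit n i j :: 'k mat) $$ (i, j) = 0\<^sub>m n n $$ (i, j)" by simp
  then show False using assms by simp
qed

text \<open>Diagonal units on both sides isolate one entry; this extracts a matrix unit from a
  homogeneous matrix.\<close>

lemma matrix_unit_mult:
  assumes "X \<in> carrier_mat n n" "i < n" "j < n"
  shows "matrix_unit n i i * X * matrix_unit n j j = X $$ (i, j) \<cdot>\<^sub>m matrix_unit n i j"
proof (rule eq_matI)
  fix a b assume "a < dim_row (X $$ (i, j) \<cdot>\<^sub>m matrix_unit n i j)"
    "b < dim_col (X $$ (i, j) \<cdot>\<^sub>m matrix_unit n i j)"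
  then have ab: "a < n" "b < n" by auto
  have row: "(matrix_unit n i i * X) $$ (a, k) = (if a = i then X $$ (i, k) else 0)" if "k < n" for k
  proof -
    have "(matrix_unit n i i * X) $$ (a, k) = (\<Sum>l<n. matrix_unit n i i $$ (a, l) * X $$ (l, k))"
      using assms ab that by (intro index_mult_mat_sum) auto
    also have "\<dots> = (\<Sum>l<n. if l = i then (if a = i then X $$ (l, k) else 0) else 0)"
      using ab by (intro sum.cong) auto
    finally show ?thesis using assms by simp
  qed
  have "(matrix_unit n i i * X * matrix_unit n j j) $$ (a, b)
      = (\<Sum>k<n. (matrix_unit n i i * X) $$ (a, k) * matrix_unit n j j $$ (k, b))"
    using assms ab by (intro index_mult_mat_sum) auto
  also have "\<dots> = (\<Sum>k<n. if k = j then (if a = i \<and> b = j then X $$ (i, k) else 0) else 0)"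
    using ab by (intro sum.cong) (auto simp: row simp del: index_mult_mat)
  also have "\<dots> = (X $$ (i, j) \<cdot>\<^sub>m matrix_unit n i j) $$ (a, b)"
    using assms ab by simp
  finally show "(matrix_unit n i i * X * matrix_unit n j j) $$ (a, b)
      = (X $$ (i, j) \<cdot>\<^sub>m matrix_unit n i j) $$ (a, b)" .
qed (use assms in auto)

section \<open>Triangular idempotents\<close>

text \<open>Expand \<open>e = e * e\<close> at \<open>(a, b)\<close>: terms with
  \<open>k < a\<close> or \<open>b < k\<close> vanish by triangularity, those with
  \<open>k = a\<close> or \<open>k = b\<close> contain a zero diagonal entry, and those in between
  vanish by induction on \<open>b - a\<close>.\<close>

lemma UT_idempotent_zero_block:
  assumes e: "e \<in> carrier (UT n)" "e * e = e"
    and "a < n" "b < n" "\<forall>k. a \<le> k \<and> k \<le> b \<longrightarrow> e $$ (k, k) = 0"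
  shows "e $$ (a, b) = 0"
  using assms(3-5)
proof (induction "b - a" arbitrary: a b rule: less_induct)
  case less
  show ?case
  proof (cases "a < b")
    case True
    have "e $$ (a, b) = (\<Sum>k<n. e $$ (a, k) * e $$ (k, b))"
      using e True less.prems index_mult_mat_sum[of e n e a b] by (simp add: UT_carrier_mat)
    also have "\<dots> = 0"
    proof (rule sum.neutral, rule)
      fix k assume "k \<in> {..<n}"
      then have k: "k < n" by simp
      consider "k < a" | "k = a" | "a < k" "k < b" | "k = b" | "b < k" by linarith
      then show "e $$ (a, k) * e $$ (k, b) = 0"
      proof cases
        case 3
        then have "e $$ (a, k) = 0"
          using less.prems k by (intro less.hyps) auto
        then show ?thesis by simp
      qed (use e k True less.prems UT_below_diag[OF e(1)] in auto)
    qed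
    finally show ?thesis .
  qed (use e less.prems UT_below_diag[OF e(1)] in \<open>cases "a = b"; auto\<close>)
qed

lemma UT_idempotent_zero_diag:
  assumes "e \<in> carrier (UT n)" "e * e = e" "\<forall>k<n. e $$ (k, k) = 0"
  shows "e = 0\<^sub>m n n"
proof (rule eq_matI)
  fix a b assume "a < dim_row (0\<^sub>m n n :: 'a mat)" "b < dim_col (0\<^sub>m n n :: 'a mat)"
  then show "e $$ (a, b) = 0\<^sub>m n n $$ (a, b)"
    using UT_idempotent_zero_block[OF assms(1,2), of a b] assms(3) by auto
qed (use UT_carrier_mat[OF assms(1)] in auto)

text \<open>In the expansion of \<open>e * e\<close> every term with \<open>k \<noteq> t\<close> has
  a factor in a block whose diagonal avoids \<open>t\<close>, so \<open>e\<close> is its column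
  \<open>t\<close> times its row \<open>t\<close>.\<close>

lemma UT_idempotent_rank_one:
  assumes e: "e \<in> carrier (UT n)" "e * e = e"
    and t: "t < n" "\<forall>k<n. k \<noteq> t \<longrightarrow> e $$ (k, k) = 0"
    and ab: "a < n" "b < n"
  shows "e $$ (a, b) = e $$ (a, t) * e $$ (t, b)"
proof -
  have 0: "e $$ (p, q) = 0" if "p < n" "q < n" "t < p \<or> q < t" for p q
    using that t by (intro UT_idempotent_zero_block[OF e]) auto
  have "e $$ (a, b) = (\<Sum>k<n. e $$ (a, k) * e $$ (k, b))"
    using e ab index_mult_mat_sum[of e n e a b] by (simp add: UT_carrier_mat)
  also have "\<dots> = (\<Sum>k\<in>{t}. e $$ (a, k) * e $$ (k, b))"
  proof (rule sum.mono_neutral_right)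
    show "\<forall>k\<in>{..<n} - {t}. e $$ (a, k) * e $$ (k, b) = 0"
    proof
      fix k assume "k \<in> {..<n} - {t}"
      then have "k < n" "k < t \<or> t < k" by auto
      then show "e $$ (a, k) * e $$ (k, b) = 0" using 0 ab by auto
    qed
  qed (use t in auto)
  finally show ?thesis by simp
qed

text \<open>Factoring \<open>e\<close> through \<open>s\<close> and \<open>f\<close> through
  \<open>t\<close> makes each entry of \<open>X\<close> equal to
  \<open>e $$ (a, s) * X $$ (s, t) * f $$ (t, b)\<close>, so a zero at \<open>(s, t)\<close> would
  kill all of \<open>X\<close>.\<close>

lemma UT_rank_one_corner_nonzero:
  assumes e: "e \<in> carrier (UT n)" "e * e = e" "s < n" "\<forall>k<n. k \<noteq> s \<longrightarrow> e $$ (k, k) = 0"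
    and f: "f \<in> carrier (UT n)" "f * f = f" "t < n" "\<forall>k<n. k \<noteq> t \<longrightarrow> f $$ (k, k) = 0"
    and X: "X \<in> carrier_mat n n" "e * X = X" "X * f = X" "X \<noteq> 0\<^sub>m n n"
  shows "X $$ (s, t) \<noteq> 0"
proof
  assume st: "X $$ (s, t) = 0"
  note cm = UT_carrier_mat[OF e(1)] UT_carrier_mat[OF f(1)]
  have row: "X $$ (a, b) = e $$ (a, s) * X $$ (s, b)" if "a < n" "b < n" for a b
  proof -
    have "X $$ (a, b) = (\<Sum>k<n. e $$ (a, k) * X $$ (k, b))"
      using index_mult_mat_sum[OF cm(1) X(1) that] X by simp
    also have "\<dots> = (\<Sum>k<n. e $$ (a, s) * (e $$ (s, k) * X $$ (k, b)))"
      using UT_idempotent_rank_one[OF e that(1)] by (intro sum.cong) (auto simp: mult.assoc)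
    also have "\<dots> = e $$ (a, s) * X $$ (s, b)"
      using index_mult_mat_sum[OF cm(1) X(1) e(3) that(2)] X by (simp add: sum_distrib_left)
    finally show ?thesis .
  qed
  have col: "X $$ (a, b) = X $$ (a, t) * f $$ (t, b)" if "a < n" "b < n" for a b
  proof -
    have "X $$ (a, b) = (\<Sum>k<n. X $$ (a, k) * f $$ (k, b))"
      using index_mult_mat_sum[OF X(1) cm(2) that] X by simp
    also have "\<dots> = (\<Sum>k<n. (X $$ (a, k) * f $$ (k, t)) * f $$ (t, b))"
      using UT_idempotent_rank_one[OF f _ that(2)] by (intro sum.cong) (auto simp: mult.assoc)
    also have "\<dots> = X $$ (a, t) * f $$ (t, b)"
      using index_mult_mat_sum[OF X(1) cm(2) that(1) f(3)] X by (simp add: sum_distrib_right)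
    finally show ?thesis .
  qed
  have "X $$ (a, b) = 0" if "a < n" "b < n" for a b
    using row[OF that] col[OF e(3) that(2)] st by simp
  then have "X = 0\<^sub>m n n" using X(1) by (intro eq_matI) auto
  with X(4) show False by simp
qed

text \<open>Each step up from \<open>0\<close> lowers \<tau> by at least one, which bounds
  \<open>\<tau> i\<close> from above; each step down from \<open>n - 1\<close> raises it by at least
  one, which bounds it from below.\<close>

lemma strict_antitone_eq_reflection:
  fixes \<tau> :: "nat \<Rightarrow> nat"
  assumes lt: "\<And>i. i < n \<Longrightarrow> \<tau> i < n"
    and anti: "\<And>i j. i < j \<Longrightarrow> j < n \<Longrightarrow> \<tau> j < \<tau> i"
    and "i < n"
  shows "\<tau> i = n - 1 - i"
proof -
  have up: "i < n \<Longrightarrow> \<tau> i + i < n" for i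
  proof (induction i)
    case (Suc i)
    then show ?case using anti[of i "Suc i"] by simp
  qed (use lt in simp)
  have "d < n \<Longrightarrow> d \<le> \<tau> (n - 1 - d)" for d
  proof (induction d)
    case (Suc d)
    then have "n - 1 - Suc d < n - 1 - d" "n - 1 - d < n" by auto
    then have "\<tau> (n - 1 - d) < \<tau> (n - 1 - Suc d)" by (rule anti)
    then show ?case using Suc by simp
  qed simp
  from this[of "n - 1 - i"] have "n - 1 - i \<le> \<tau> i" using \<open>i < n\<close> by simp
  with up[OF \<open>i < n\<close>] show ?thesis by linarith
qed

section \<open>Antiautomorphisms\<close>

text \<open>The position is where the reflection of \<open>matrix_unit n i j\<close> has its 1. The
  grading later turns this nonzero entry into membership of a matrix unit in a component.\<close>

lemma antiautomorphism_matrix_unit_entry: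
  fixes \<phi> :: "'k::field mat \<Rightarrow> 'k mat"
  assumes \<phi>: "antiautomorphism (UT n) \<phi>" and ij: "i \<le> j" "j < n"
  shows "\<phi> (matrix_unit n i j) $$ (n - 1 - j, n - 1 - i) \<noteq> 0"
proof -
  let ?A = "UT n :: ('k, 'k mat) module"
  let ?E = "matrix_unit n :: nat \<Rightarrow> nat \<Rightarrow> 'k mat"
  have bij: "bij_betw \<phi> (carrier ?A) (carrier ?A)" and lin: "linear_map class_ring ?A ?A \<phi>"
    and anti: "\<And>x y. x \<in> carrier ?A \<Longrightarrow> y \<in> carrier ?A \<Longrightarrow> \<phi> (x * y) = \<phi> y * \<phi> x"
    using \<phi> by (auto simp: antiautomorphism_def UT_simps)
  have closed: "\<phi> x \<in> carrier ?A" if "x \<in> carrier ?A" for x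
    using bij that by (auto simp: bij_betw_def)
  have zero_in: "0\<^sub>m n n \<in> carrier ?A" by (simp add: UT_simps)
  have "\<phi> (c \<cdot>\<^sub>m x) = c \<cdot>\<^sub>m \<phi> x" if "x \<in> carrier ?A" for c x
    using lin that unfolding linear_map_def mod_hom_def mod_hom_axioms_def LinearCombinations.module_hom_def
    by (auto simp: UT_simps class_ring_simps)
  from this[OF zero_in, of 0] have "\<phi> (0 \<cdot>\<^sub>m 0\<^sub>m n n) = 0 \<cdot>\<^sub>m \<phi> (0\<^sub>m n n)" .
  moreover have "0 \<cdot>\<^sub>m X = 0\<^sub>m n n" if "X \<in> carrier_mat n n" for X :: "'k mat"
    using that by (intro eq_matI) auto
  ultimately have phi0: "\<phi> (0\<^sub>m n n) = 0\<^sub>m n n"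
    using closed[OF zero_in] by (simp add: UT_carrier_mat)
  have nz: "\<phi> x \<noteq> 0\<^sub>m n n" if "x \<in> carrier ?A" "x \<noteq> 0\<^sub>m n n" for x
    using that bij zero_in phi0 by (metis bij_betw_def inj_onD)
  have E_mult: "?E p q * ?E r s = (if q = r then ?E p s else 0\<^sub>m n n)"
    if "p < n" "q < n" "r < n" "s < n" for p q r s
  proof (rule eq_matI)
    fix a b assume "a < dim_row (if q = r then ?E p s else 0\<^sub>m n n)"
      "b < dim_col (if q = r then ?E p s else 0\<^sub>m n n)"
    then have ab: "a < n" "b < n" by (auto split: if_splits)
    have "(?E p q * ?E r s) $$ (a, b) = (\<Sum>k<n. ?E p q $$ (a, k) * ?E r s $$ (k, b))"
      using ab by (intro index_mult_mat_sum) auto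
    also have "\<dots> = (\<Sum>k<n. if k = q then (if a = p \<and> q = r \<and> b = s then 1 else 0) else 0)"
      using ab by (intro sum.cong) auto
    finally show "(?E p q * ?E r s) $$ (a, b) = (if q = r then ?E p s else 0\<^sub>m n n) $$ (a, b)"
      using ab that by auto
  qed auto
  define e where "e i = \<phi> (?E i i)" for i
  have e_in: "e i \<in> carrier ?A" if "i < n" for i
    using that by (simp add: e_def closed matrix_unit_in_UT)
  have e_mult: "e i * e j = (if i = j then e i else 0\<^sub>m n n)" if "i < n" "j < n" for i j
    using that anti[of "?E j j" "?E i i", symmetric]
    by (auto simp: e_def matrix_unit_in_UT E_mult phi0)
  \<comment> \<open>\<open>e i\<close> is an idempotent, nonzero by injectivity of \<phi>, so its
    diagonal cannot vanish; \<open>\<tau> i\<close> picks a nonzero position.\<close>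
  have "\<exists>t<n. e i $$ (t, t) \<noteq> 0" if "i < n" for i
    using UT_idempotent_zero_diag[OF e_in[OF that]] e_mult[OF that that]
      nz[OF matrix_unit_in_UT[of i i n]] matrix_unit_nonzero that by (auto simp: e_def)
  then obtain \<tau> where \<tau>: "\<And>i. i < n \<Longrightarrow> \<tau> i < n \<and> e i $$ (\<tau> i, \<tau> i) \<noteq> 0" by metis
  have orth: "e i $$ (k, k) * e j $$ (k, k) = 0" if "i < n" "j < n" "i \<noteq> j" "k < n" for i j k
    using UT_mult_diag[OF e_in e_in, of i j k] e_mult[of i j] that by simp
  have inj: "inj_on \<tau> {..<n}"
  proof (rule inj_onI, rule ccontr)
    fix p q assume "p \<in> {..<n}" "q \<in> {..<n}" "\<tau> p = \<tau> q" "p \<noteq> q"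
    then show False using orth[of p q "\<tau> p"] \<tau>[of p] \<tau>[of q] by auto
  qed
  \<comment> \<open>An injective self-map of a finite set is onto, so every diagonal position is
    some \<open>\<tau> j\<close>. By \<open>orth\<close> only \<open>e j\<close> is nonzero
    there.\<close>
  have "\<tau> ` {..<n} = {..<n}"
    using \<tau> inj by (intro endo_inj_surj) auto
  then have diag: "e i $$ (k, k) = 0" if "i < n" "k < n" "k \<noteq> \<tau> i" for i k
  proof -
    have "k \<in> \<tau> ` {..<n}"
      using \<open>\<tau> ` {..<n} = {..<n}\<close> that by simp
    then obtain j where j: "j < n" "k = \<tau> j" by auto
    then have "i \<noteq> j" using that by auto
    then show ?thesis using orth[OF that(1) j(1) _ that(2)] \<tau>[OF j(1)] j by auto
  qed
  \<comment> \<open>Since \<phi> reverses products, \<open>?E p q * ?E q q\<close> puts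
    \<open>e q\<close> on the left and \<open>?E p p * ?E p q\<close> puts \<open>e p\<close> on the
    right; hence the swapped corner.\<close>
  have corner: "\<phi> (?E p q) $$ (\<tau> q, \<tau> p) \<noteq> 0" if pq: "p \<le> q" "q < n" for p q
  proof (rule UT_rank_one_corner_nonzero[of "e q" _ _ "e p"])
    show "e q * \<phi> (?E p q) = \<phi> (?E p q)"
      using anti[of "?E p q" "?E q q"] pq by (simp add: e_def matrix_unit_in_UT E_mult)
    show "\<phi> (?E p q) * e p = \<phi> (?E p q)"
      using anti[of "?E p p" "?E p q"] pq by (simp add: e_def matrix_unit_in_UT E_mult)
    show "\<phi> (?E p q) \<noteq> 0\<^sub>m n n"
      using pq by (intro nz matrix_unit_in_UT matrix_unit_nonzero) auto
    show "\<phi> (?E p q) \<in> carrier_mat n n"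
      using pq by (intro UT_carrier_mat closed matrix_unit_in_UT)
  qed (use pq e_in e_mult \<tau> diag in auto)
  \<comment> \<open>A nonzero entry at \<open>(\<tau> q, \<tau> p)\<close> of a triangular matrix
    gives \<open>\<tau> q \<le> \<tau> p\<close>; injectivity excludes equality.\<close>
  have "\<tau> q < \<tau> p" if "p < q" "q < n" for p q
  proof -
    have "\<tau> q \<noteq> \<tau> p" using inj that by (auto dest: inj_onD)
    moreover have "\<not> \<tau> p < \<tau> q"
      using corner[of p q] that \<tau>[of q] UT_below_diag[OF closed[OF matrix_unit_in_UT[of p q n]]]
      by auto
    ultimately show ?thesis by simp
  qed
  then have "\<tau> k = n - 1 - k" if "k < n" for k
    using that \<tau> by (intro strict_antitone_eq_reflection) auto
  then show ?thesis using corner[OF ij] ij by simp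
qed

section \<open>Elementary gradings\<close>

text \<open>Otherwise \<open>x\<close> would have two decompositions, one concentrated at
  \<open>g\<close> and one at \<open>h\<close>.\<close>

lemma group_grading_disjoint:
  fixes \<Gamma> :: "'g \<Rightarrow> 'k::field mat set"
  assumes gr: "group_grading G (UT n) \<Gamma>" and g: "g \<in> carrier G" and h: "h \<in> carrier G"
    and x: "x \<in> \<Gamma> g" "x \<in> \<Gamma> h" "x \<noteq> 0\<^sub>m n n"
  shows "g = h"
proof (rule ccontr)
  assume "g \<noteq> h"
  let ?A = "UT n :: ('k, 'k mat) module"
  interpret A: Module.module class_ring ?A
    using vectorspace_UT by (auto simp: vectorspace_def)
  have sub: "LinearCombinations.submodule class_ring (\<Gamma> k) ?A" if "k \<in> carrier G" for k
    using gr that by (auto simp: group_grading_def subspace_def)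
  have x_in: "x \<in> carrier ?A"
    using submodule.subset[OF sub[OF g]] x by auto
  \<comment> \<open>Restricted to \<open>carrier G\<close> because uniqueness in
    \<open>group_grading\<close> concerns extensional families.\<close>
  define f where "f k = (\<lambda>l\<in>carrier G. if l = k then x else \<zero>\<^bsub>?A\<^esub>)" for k
  have dec: "f k \<in> (\<Pi>\<^sub>E l\<in>carrier G. \<Gamma> l) \<and> finite {l \<in> carrier G. f k l \<noteq> \<zero>\<^bsub>?A\<^esub>} \<and>
      x = finsum ?A (f k) {l \<in> carrier G. f k l \<noteq> \<zero>\<^bsub>?A\<^esub>}" if k: "k \<in> carrier G" "x \<in> \<Gamma> k" for k
  proof -
    have "{l \<in> carrier G. f k l \<noteq> \<zero>\<^bsub>?A\<^esub>} = {k}"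
      using k x by (auto simp: f_def UT_simps)
    moreover have "finsum ?A (f k) {k} = x"
      using A.finsum_insert[of "{}" k "f k"] k x_in by (simp add: f_def)
    moreover have "f k \<in> (\<Pi>\<^sub>E l\<in>carrier G. \<Gamma> l)"
      using k submodule.zero_closed[OF sub] by (auto simp: f_def)
    ultimately show ?thesis by simp
  qed
  have "f g = f h"
    using gr x_in dec[OF g x(1)] dec[OF h x(2)] unfolding group_grading_def by blast
  then have "f g g = f h g" by simp
  then show False using \<open>g \<noteq> h\<close> g x(3) by (simp add: f_def UT_simps)
qed

text \<open>Sum the scaled matrix units of the nonzero entries. With
  \<open>elementary_grading_unit_mem\<close> this says that a component is spanned by the matrix
  units in it.\<close>

lemma UT_submodule_memI:
  fixes S :: "'k::field mat set"
  assumes sub: "LinearCombinations.submodule class_ring S (UT n :: ('k, 'k mat) module)"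
    and X: "X \<in> carrier_mat n n"
    and units: "\<And>i j. i < n \<Longrightarrow> j < n \<Longrightarrow> X $$ (i, j) \<noteq> 0 \<Longrightarrow> matrix_unit n i j \<in> S"
  shows "X \<in> S"
proof -
  define Y where "Y P = mat n n (\<lambda>p. if p \<in> P then X $$ p else 0)" for P
  have "P \<subseteq> {..<n} \<times> {..<n} \<Longrightarrow> Y P \<in> S" if "finite P" for P
    using that
  proof (induction P rule: finite_induct)
    case empty
    have "Y {} = 0\<^sub>m n n" by (intro eq_matI) (auto simp: Y_def)
    then show ?case using submodule.zero_closed[OF sub] by (simp add: UT_simps)
  next
    case (insert p P)
    obtain i j where p: "p = (i, j)" by fastforce
    have Y: "Y (insert p P) = Y P + X $$ (i, j) \<cdot>\<^sub>m matrix_unit n i j"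
      using insert.hyps p by (intro eq_matI) (auto simp: Y_def matrix_unit_def)
    show ?case
    proof (cases "X $$ (i, j) = 0")
      case True
      then have "Y (insert p P) = Y P" using p by (intro eq_matI) (auto simp: Y_def)
      then show ?thesis using insert by simp
    next
      case False
      then have "matrix_unit n i j \<in> S" using units insert.prems p by auto
      then have "X $$ (i, j) \<cdot>\<^sub>m matrix_unit n i j \<in> S"
        using submodule.smult_closed[OF sub] by (simp add: UT_simps class_ring_simps)
      then show ?thesis
        using submodule.m_closed[OF sub] insert Y by (simp add: UT_simps)
    qed
  qed
  then have "Y ({..<n} \<times> {..<n}) \<in> S" by simp
  moreover have "Y ({..<n} \<times> {..<n}) = X" using X by (intro eq_matI) (auto simp: Y_def)
  ultimately show ?thesis by simp
qed

text \<open>Diagonal units have the identity as degree, so multiplying by them preserves the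
  component; the isolated entry is then scaled to 1.\<close>

lemma elementary_grading_unit_mem:
  fixes \<Gamma> :: "'g \<Rightarrow> 'k::field mat set"
  assumes G: "group G" and el: "elementary_grading G n \<Gamma>" and g: "g \<in> carrier G"
    and X: "X \<in> \<Gamma> g" and ij: "i < n" "j < n" "X $$ (i, j) \<noteq> 0"
  shows "matrix_unit n i j \<in> \<Gamma> g"
proof -
  let ?A = "UT n :: ('k, 'k mat) module"
  interpret group G by fact
  from el obtain h where gr: "group_grading G ?A \<Gamma>" and h: "h \<in> {..<n} \<rightarrow> carrier G"
    and deg: "\<And>i j. i \<le> j \<Longrightarrow> j < n \<Longrightarrow> matrix_unit n i j \<in> \<Gamma> (inv\<^bsub>G\<^esub> h i \<otimes>\<^bsub>G\<^esub> h j)"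
    by (auto simp: elementary_grading_def)
  have diag: "matrix_unit n k k \<in> \<Gamma> \<one>\<^bsub>G\<^esub>" if "k < n" for k
    using deg[of k k] h that by (simp add: Pi_iff)
  have sub: "LinearCombinations.submodule class_ring (\<Gamma> g) ?A"
    using gr g by (auto simp: group_grading_def subspace_def)
  have mult: "x * y \<in> \<Gamma> (a \<otimes>\<^bsub>G\<^esub> b)"
    if "a \<in> carrier G" "b \<in> carrier G" "x \<in> \<Gamma> a" "y \<in> \<Gamma> b" for a b x y
    using gr that by (auto simp: group_grading_def UT_simps)
  have Xc: "X \<in> carrier_mat n n"
    using submodule.subset[OF sub] X by (auto simp: UT_simps)
  have "matrix_unit n i i * X \<in> \<Gamma> g"
    using mult[OF one_closed g diag[OF ij(1)] X] g by simp
  then have "matrix_unit n i i * X * matrix_unit n j j \<in> \<Gamma> g"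
    using mult[OF g one_closed _ diag[OF ij(2)]] g by simp
  then have "X $$ (i, j) \<cdot>\<^sub>m matrix_unit n i j \<in> \<Gamma> g"
    using matrix_unit_mult[OF Xc ij(1,2)] by simp
  then have "inverse (X $$ (i, j)) \<cdot>\<^sub>m (X $$ (i, j) \<cdot>\<^sub>m matrix_unit n i j) \<in> \<Gamma> g"
    using submodule.smult_closed[OF sub] by (simp add: UT_simps class_ring_simps)
  moreover have "inverse (X $$ (i, j)) \<cdot>\<^sub>m (X $$ (i, j) \<cdot>\<^sub>m matrix_unit n i j)
      = (matrix_unit n i j :: 'k mat)"
    using ij(3) by (intro eq_matI) (auto simp: matrix_unit_def)
  ultimately show ?thesis by simp
qed

section \<open>Degree maps and their transfer to the reflection\<close>

text \<open>The components at \<open>\<sigma> g\<close> and \<open>\<theta> g\<close> are the same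
  image under \<psi>, which is nonzero because \<open>\<sigma> g\<close> is in the support.\<close>

lemma theta_homogeneous_unique:
  fixes \<Gamma> :: "'g \<Rightarrow> 'k::field mat set"
  assumes gr: "group_grading G (UT n) \<Gamma>"
    and \<sigma>: "theta_homogeneous G (UT n) \<Gamma> \<sigma> \<psi>" and \<theta>: "theta_homogeneous G (UT n) \<Gamma> \<theta> \<psi>"
    and g: "g \<in> support G (UT n) \<Gamma>"
  shows "\<sigma> g = \<theta> g"
proof -
  let ?S = "support G (UT n :: ('k, 'k mat) module) \<Gamma>"
  have mem: "\<sigma> g \<in> ?S" "\<theta> g \<in> ?S"
    using \<sigma> \<theta> g by (auto simp: theta_homogeneous_def bij_betw_def)
  have eq: "\<Gamma> (\<sigma> g) = \<Gamma> (\<theta> g)"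
    using \<sigma> \<theta> g by (auto simp: theta_homogeneous_def)
  have carr: "\<sigma> g \<in> carrier G" "\<theta> g \<in> carrier G" using mem by (auto simp: support_def)
  have "0\<^sub>m n n \<in> \<Gamma> (\<sigma> g)"
    using gr carr(1) submodule.zero_closed[of class_ring "\<Gamma> (\<sigma> g)" "UT n :: ('k, 'k mat) module"]
    by (auto simp: group_grading_def subspace_def UT_simps)
  then obtain x where "x \<in> \<Gamma> (\<sigma> g)" "x \<noteq> 0\<^sub>m n n"
    using mem(1) by (auto simp: support_def UT_simps)
  then show ?thesis using group_grading_disjoint[OF gr carr] eq by blast
qed

text \<open>Components are determined by their matrix units, so it suffices to compare degrees of
  units: \<open>unit\<close> and \<open>unit_conv\<close> relate each unit in
  \<open>\<Gamma> g\<close> to its reflection in \<open>\<Gamma> (\<sigma> g)\<close>.\<close>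

lemma canonical_theta_homogeneous:
  fixes \<Gamma> :: "'g \<Rightarrow> 'k::field mat set"
  assumes G: "group G" and el: "elementary_grading G n \<Gamma>"
    and anti: "antiautomorphism (UT n) \<phi>" and hom: "theta_homogeneous G (UT n) \<Gamma> \<sigma> \<phi>"
  shows "theta_homogeneous G (UT n) \<Gamma> \<sigma> (canonical_involution n)"
proof -
  let ?A = "UT n :: ('k, 'k mat) module"
  let ?S = "support G ?A \<Gamma>"
  let ?c = "canonical_involution n :: 'k mat \<Rightarrow> 'k mat"
  interpret group G by fact
  from el obtain h where gr: "group_grading G ?A \<Gamma>" and h: "h \<in> {..<n} \<rightarrow> carrier G"
    and deg: "\<And>i j. i \<le> j \<Longrightarrow> j < n \<Longrightarrow> matrix_unit n i j \<in> \<Gamma> (inv\<^bsub>G\<^esub> h i \<otimes>\<^bsub>G\<^esub> h j)"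
    by (auto simp: elementary_grading_def)
  have bij: "bij_betw \<sigma> ?S ?S" and im: "\<And>g. g \<in> ?S \<Longrightarrow> \<phi> ` \<Gamma> g = \<Gamma> (\<sigma> g)"
    using hom by (auto simp: theta_homogeneous_def)
  have \<sigma>S: "\<sigma> g \<in> ?S" if "g \<in> ?S" for g
    using bij that by (auto simp: bij_betw_def)
  have S: "g \<in> carrier G" if "g \<in> ?S" for g using that by (simp add: support_def)
  have sub: "LinearCombinations.submodule class_ring (\<Gamma> g) ?A" if "g \<in> ?S" for g
    using gr S[OF that] by (auto simp: group_grading_def subspace_def)
  have in_UT: "X \<in> carrier ?A" if "g \<in> ?S" "X \<in> \<Gamma> g" for g X
    using submodule.subset[OF sub[OF that(1)]] that by auto
  have unit: "matrix_unit n (n - 1 - j) (n - 1 - i) \<in> \<Gamma> (\<sigma> g)"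
    if "g \<in> ?S" "i \<le> j" "j < n" "matrix_unit n i j \<in> \<Gamma> g" for g i j
    using that im[OF that(1)] antiautomorphism_matrix_unit_entry[OF anti that(2,3)] S[OF \<sigma>S]
    by (intro elementary_grading_unit_mem[OF G el, where X = "\<phi> (matrix_unit n i j)"]) auto
  \<comment> \<open>The unit has a degree \<open>d\<close> from the elementary grading. Its
    reflection lies in both \<open>\<Gamma> (\<sigma> d)\<close> and
    \<open>\<Gamma> (\<sigma> g)\<close>, so \<open>\<sigma> d = \<sigma> g\<close>, and injectivity
    of \<sigma> gives \<open>d = g\<close>.\<close>
  have unit_conv: "matrix_unit n i j \<in> \<Gamma> g"
    if "g \<in> ?S" "i \<le> j" "j < n" "matrix_unit n (n - 1 - j) (n - 1 - i) \<in> \<Gamma> (\<sigma> g)" for g i j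
  proof -
    define d where "d = inv\<^bsub>G\<^esub> h i \<otimes>\<^bsub>G\<^esub> h j"
    have d: "matrix_unit n i j \<in> \<Gamma> d" using deg that by (simp add: d_def)
    have "d \<in> carrier G" using h that by (simp add: d_def Pi_iff)
    then have dS: "d \<in> ?S" using d matrix_unit_nonzero[of i n j] that by (auto simp: support_def UT_simps)
    have "\<sigma> d = \<sigma> g"
      using unit[OF dS that(2,3) d] that matrix_unit_nonzero[of "n - 1 - j" n "n - 1 - i"] \<sigma>S S dS
      by (intro group_grading_disjoint[OF gr]) auto
    then have "d = g" using bij dS that(1) by (auto simp: bij_betw_def dest: inj_onD)
    then show ?thesis using d by simp
  qed
  have c_carrier: "?c X \<in> carrier_mat n n" for X
    by (simp add: canonical_involution_def)
  have entry: "?c X $$ (a, b) = X $$ (n - 1 - b, n - 1 - a)" if "a < n" "b < n" for X a b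
    using that by (simp add: canonical_involution_def)
  \<comment> \<open>\<open>unit\<close> and \<open>unit_conv\<close> cover only positions on or
    above the diagonal; a reflected triangular matrix has no other nonzero entries.\<close>
  have upper: "a \<le> b"
    if "X \<in> carrier ?A" "a < n" "b < n" "X $$ (n - 1 - b, n - 1 - a) \<noteq> 0" for X a b
  proof (rule ccontr)
    assume "\<not> a \<le> b"
    with that(2,3) have "n - 1 - b < n" "n - 1 - a < n - 1 - b" by auto
    then show False using UT_below_diag[OF that(1)] that(4) by blast
  qed
  have invol: "?c (?c X) = X" if "X \<in> carrier ?A" for X
    using involution_canonical_involution[of n] that by (auto simp: involution_def)
  have "?c ` \<Gamma> g = \<Gamma> (\<sigma> g)" if g: "g \<in> ?S" for g
  proof
    show "?c ` \<Gamma> g \<subseteq> \<Gamma> (\<sigma> g)"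
    proof
      fix Y assume "Y \<in> ?c ` \<Gamma> g"
      then obtain X where X: "X \<in> \<Gamma> g" "Y = ?c X" by blast
      show "Y \<in> \<Gamma> (\<sigma> g)" unfolding X(2)
      proof (rule UT_submodule_memI[OF sub[OF \<sigma>S[OF g]] c_carrier])
        fix a b assume ab: "a < n" "b < n" "?c X $$ (a, b) \<noteq> 0"
        then have nz: "X $$ (n - 1 - b, n - 1 - a) \<noteq> 0" by (simp add: entry)
        then have "a \<le> b"
          by (rule upper[OF in_UT[OF g X(1)] ab(1,2)])
        moreover have "matrix_unit n (n - 1 - b) (n - 1 - a) \<in> \<Gamma> g"
          using elementary_grading_unit_mem[OF G el S[OF g] X(1) _ _ nz] ab by simp
        \<comment> \<open>Reflecting \<open>(n - 1 - b, n - 1 - a)\<close> returns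
          \<open>(a, b)\<close>, as both indices are below \<open>n\<close>.\<close>
        ultimately show "matrix_unit n a b \<in> \<Gamma> (\<sigma> g)"
          using unit[OF g, of "n - 1 - b" "n - 1 - a"] ab by simp
      qed
    qed
    show "\<Gamma> (\<sigma> g) \<subseteq> ?c ` \<Gamma> g"
    proof
      fix Y assume Y: "Y \<in> \<Gamma> (\<sigma> g)"
      have Y_UT: "Y \<in> carrier ?A" using in_UT[OF \<sigma>S[OF g] Y] .
      \<comment> \<open>The reflection is its own inverse, so \<open>?c Y\<close> is the preimage of
        \<open>Y\<close>.\<close>
      have "?c Y \<in> \<Gamma> g"
      proof (rule UT_submodule_memI[OF sub[OF g] c_carrier])
        fix a b assume ab: "a < n" "b < n" "?c Y $$ (a, b) \<noteq> 0"
        then have nz: "Y $$ (n - 1 - b, n - 1 - a) \<noteq> 0" by (simp add: entry)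
        then have "a \<le> b"
          by (rule upper[OF Y_UT ab(1,2)])
        moreover have "matrix_unit n (n - 1 - b) (n - 1 - a) \<in> \<Gamma> (\<sigma> g)"
          using elementary_grading_unit_mem[OF G el S[OF \<sigma>S[OF g]] Y _ _ nz] ab by simp
        ultimately show "matrix_unit n a b \<in> \<Gamma> g"
          using unit_conv[OF g] ab by simp
      qed
      then show "Y \<in> ?c ` \<Gamma> g" using invol[OF Y_UT] by (metis imageI)
    qed
  qed
  then show ?thesis using bij by (simp add: theta_homogeneous_def)
qed

theorem corollary3p8:
  fixes G :: "('g, 'b) monoid_scheme"
    and n :: nat
    and \<Gamma> :: "'g \<Rightarrow> 'k::field mat set"
    and \<theta> :: "'g \<Rightarrow> 'g"
  assumes "CHAR('k) \<noteq> 2"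
    and "group G"
    and "n \<ge> 1"
    and "elementary_grading G n \<Gamma>"
    and "bij_betw \<theta> (support G (UT n) \<Gamma>) (support G (UT n) \<Gamma>)"
  shows "(\<forall>\<phi>. antiautomorphism (UT n) \<phi> \<and> homogeneous G (UT n) \<Gamma> \<phi> \<longrightarrow>
            (theta_homogeneous G (UT n) \<Gamma> \<theta> \<phi> \<longleftrightarrow>
             theta_homogeneous G (UT n) \<Gamma> \<theta> (canonical_involution n))) \<and>
         (\<forall>\<phi>. involution (UT n) \<phi> \<and> homogeneous G (UT n) \<Gamma> \<phi> \<longrightarrow>
            (theta_homogeneous G (UT n) \<Gamma> \<theta> \<phi> \<longleftrightarrow>
             theta_homogeneous G (UT n) \<Gamma> \<theta> (canonical_involution n)))"
proof -
  let ?A = "UT n :: ('k, 'k mat) module"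
  have gr: "group_grading G ?A \<Gamma>" using assms(4) by (simp add: elementary_grading_def)
  have key: "theta_homogeneous G ?A \<Gamma> \<theta> \<phi> \<longleftrightarrow>
      theta_homogeneous G ?A \<Gamma> \<theta> (canonical_involution n)"
    if \<phi>: "antiautomorphism ?A \<phi>" "homogeneous G ?A \<Gamma> \<phi>" for \<phi>
  proof
    assume "theta_homogeneous G ?A \<Gamma> \<theta> \<phi>"
    then show "theta_homogeneous G ?A \<Gamma> \<theta> (canonical_involution n)"
      by (rule canonical_theta_homogeneous[OF assms(2,4) \<phi>(1)])
  next
    assume c: "theta_homogeneous G ?A \<Gamma> \<theta> (canonical_involution n)"
    \<comment> \<open>Homogeneity supplies only some degree map \<sigma>; the reflection inherits
      it, so by uniqueness it agrees with \<theta> on the support.\<close>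
    from \<phi>(2) obtain \<sigma> where \<sigma>: "theta_homogeneous G ?A \<Gamma> \<sigma> \<phi>"
      by (auto simp: homogeneous_def)
    then have "\<sigma> g = \<theta> g" if "g \<in> support G ?A \<Gamma>" for g
      using theta_homogeneous_unique[OF gr _ c that]
        canonical_theta_homogeneous[OF assms(2,4) \<phi>(1)] by blast
    then show "theta_homogeneous G ?A \<Gamma> \<theta> \<phi>"
      using \<sigma> assms(5) by (simp add: theta_homogeneous_def)
  qed
  then show ?thesis by (auto simp: involution_def)
qed

end
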